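(* There are absolute constants $C>0$ and $a_0\in(0,1)$ such that for all $a\in(a_0,1)$, \[ \dim_\infty(\nu_a)\ \ge\ 1-C(1-a)^2\log\bigl(1/(1-a)\bigr). \]
   Context: For $a\in(0,1)$, the (unbiased) Bernoulli convolution $\nu_a$ is the distribution of the random sum $\sum_{n=1}^\infty\pm a^n$, where the signs are independent and identically distributed with equal probabilities. For a Borel probability measure $\mu$ on $\mathbb{R}$, the Frostman exponent ($L^\infty$-dimension) is \[ \dim_\infty(\mu)=\liminf_{r\downarrow 0}\frac{\log\sup_{x\in\operatorname{supp}(\mu)}\mu(B(x,r))}{\log r}, \] where $B(x,r)$ is the ball (interval) of center $x$ and radius $r$. *)

theory Defs
  imports "HOL-Probability.Probability"
begin

(* Fair coin tosses indexed by nat; index n carries the sign of the power a ^ (n + 1),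
   so that the series starts with the first power of a. *)
definition coin_space :: "(nat \<Rightarrow> bool) measure" where
  "coin_space = PiM UNIV (\<lambda>_. measure_pmf (pmf_of_set (UNIV :: bool set)))"

definition sign_of :: "bool \<Rightarrow> real" where
  "sign_of b = (if b then 1 else -1)"

definition bernoulli_convolution :: "real \<Rightarrow> real measure" where
  "bernoulli_convolution a =
     distr coin_space borel (\<lambda>\<omega>. \<Sum>n. sign_of (\<omega> n) * a ^ Suc n)"

definition measure_support :: "'a::topological_space measure \<Rightarrow> 'a set" where
  "measure_support M = {x. \<forall>U. open U \<longrightarrow> x \<in> U \<longrightarrow> emeasure M U > 0}"

(* Meant for Borel probability measures: then the support is nonempty and the supremum lies
   in (0,1], so neither the real-valued supremum nor ln takes a default value.
   The lower limit is formed in the extended reals. *)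
definition frostman_exponent :: "real measure \<Rightarrow> ereal" where
  "frostman_exponent M =
     Liminf (at_right 0)
       (\<lambda>r. ereal (ln (SUP x\<in>measure_support M. measure M (ball x r)) / ln r))"

end

theory Submission
  imports Defs
begin

text \<open>
  Write \<open>\<epsilon> = 1 - a\<close>. The characteristic function \<open>\<phi>\<close> of the Bernoulli convolution is an infinite
  product of the factors \<open>cos (a\<^sup>j t)\<close>, and by an Esseen type inequality the mass of an interval of
  radius \<open>r\<close> is at most \<open>2 r\<close> times the largest integral of \<open>\<bar>\<phi>\<bar>\<close> over an interval of length
  \<open>1 / r\<close>. So it suffices to show that these integrals grow very slowly as \<open>r\<close> tends to \<open>0\<close>.

  The factors are grouped into blocks of \<open>p\<close> consecutive ones, with \<open>p\<close> of order \<open>1 / \<epsilon>\<close>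
  chosen so that \<open>a\<^sup>p \<ge> 1 / 2\<close>. The product of a block is at most \<open>exp (- \<Sum> sin\<^sup>2 / 2)\<close>, where
  \<open>sin\<^sup>2\<close> is evaluated along the orbit \<open>a\<^sup>j u\<close>. If it were large at two points \<open>u, v\<close> whose distance
  is in \<open>(1/2, 1]\<close>, then \<open>sin\<^sup>2 (a\<^sup>j (u - v))\<close> would be small on average. But \<open>a\<^sup>j (u - v)\<close> stays
  in \<open>[1/4, 1]\<close> in absolute value during the whole block, because \<open>a\<close> is close to \<open>1\<close>. So in any
  interval of length \<open>1\<close>, the points at which the block product exceeds \<open>\<delta> = exp (- p / 512)\<close> lie
  in a single interval of length \<open>1/2\<close> (\<open>cos_prod_large_diam\<close>).

  Adding one more block multiplies the length of the interval of integration by at most \<open>2\<close>, in the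
  units of that block from \<open>1/2\<close> to at most \<open>1\<close>. The integral over the exceptional half is bounded
  by the previous stage with no loss, and the rest costs a factor \<open>2 \<delta>\<close>. Thus each block multiplies
  the bound by \<open>1 + 2 \<delta>\<close> only (\<open>cos_prod_integral_le\<close>). The number of blocks needed to reach the
  frequency \<open>1 / r\<close> is about \<open>4 ln (1 / r)\<close>, so intervals of radius \<open>r\<close> have mass at most a constant
  times \<open>r powr (1 - 8 \<delta>)\<close>. Since \<open>\<delta>\<close> is exponentially small in \<open>1 / \<epsilon>\<close>, this is stronger than the
  required loss of order \<open>\<epsilon>\<^sup>2 ln (1 / \<epsilon>)\<close>.
\<close>

section \<open>Concentration and the characteristic function\<close>

text \<open>
  For independent \<open>u, v\<close> with law \<open>U\<close>, the mean of \<open>cos ((u - v) y)\<close> is \<open>\<bar>E exp (\<i> u y)\<bar>\<^sup>2 \<ge> 0\<close>, and it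
  is at least \<open>1/2\<close> when \<open>\<bar>y\<bar> \<le> 1 / R\<close>, since then all angles are at most \<open>1\<close>. So this mean, as a
  function of \<open>y = x - x0\<close>, majorises half the indicator function of the ball; by Fubini its
  \<open>M\<close>-integral is a double average of the characteristic function.
\<close>

lemma Esseen_double_average:
  assumes M: "real_distribution M" and U: "real_distribution U"
    and R: "R > 0" and supp: "AE u in U. u \<in> {0..R}"
  shows "measure M (ball x0 (1 / R)) \<le> 2 * (\<integral>v. \<integral>u. cmod (char M (u - v)) \<partial>U \<partial>U)"
proof -
  interpret M: real_distribution M by fact
  interpret U: real_distribution U by fact
  interpret UU: pair_prob_space U U ..
  interpret UUM: pair_prob_space "U \<Otimes>\<^sub>M U" M ..
  define G where "G = (\<lambda>x (v, u). cos ((u - v) * (x - x0)))"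
  have G_meas [measurable]: "(\<lambda>(w, x). G x w) \<in> borel_measurable ((U \<Otimes>\<^sub>M U) \<Otimes>\<^sub>M M)"
    unfolding G_def by measurable
  have G_meas1: "G x \<in> borel_measurable (U \<Otimes>\<^sub>M U)" for x
    unfolding G_def by measurable
  have G_int: "integrable (U \<Otimes>\<^sub>M U) (G x)" for x
    by (rule UU.integrable_const_bound[where B=1]) (auto simp: G_def G_meas1 split: prod.splits)
  have G_int_all: "integrable ((U \<Otimes>\<^sub>M U) \<Otimes>\<^sub>M M) (\<lambda>(w, x). G x w)"
    by (rule UUM.integrable_const_bound[where B=1]) (auto simp: G_def split: prod.splits)
  have nonneg: "0 \<le> (\<integral>w. G x w \<partial>(U \<Otimes>\<^sub>M U))" for x
  proof -
    have int [simp]: "integrable U (\<lambda>u. cos (u * y))" "integrable U (\<lambda>u. sin (u * y))" for y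
      by (auto intro!: U.integrable_const_bound[where B=1])
    have "(\<integral>w. G x w \<partial>(U \<Otimes>\<^sub>M U)) = (\<integral>v. \<integral>u. G x (v, u) \<partial>U \<partial>U)"
      using UU.integral_fst'[OF G_int] by simp
    also have "\<dots> = (\<integral>v. \<integral>u. cos (u * (x - x0)) * cos (v * (x - x0))
        + sin (u * (x - x0)) * sin (v * (x - x0)) \<partial>U \<partial>U)"
      by (simp add: G_def left_diff_distrib cos_diff)
    also have "\<dots> = (\<integral>u. cos (u * (x - x0)) \<partial>U)\<^sup>2 + (\<integral>u. sin (u * (x - x0)) \<partial>U)\<^sup>2"
      by (simp add: power2_eq_square)
    finally show ?thesis by simp
  qed
  have near: "1 / 2 \<le> (\<integral>w. G x w \<partial>(U \<Otimes>\<^sub>M U))" if "x \<in> ball x0 (1 / R)" for x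
  proof -
    have cos1: "1 / 2 \<le> cos y" if "\<bar>y\<bar> \<le> 1" for y :: real
      using that pi_gt3 cos_monotone_0_pi_le[of "\<bar>y\<bar>" "pi / 3"] by (simp add: cos_60)
    have "AE v in U. AE u in U. 1 / 2 \<le> G x (v, u)"
      using supp
    proof eventually_elim
      case v: (elim v)
      show ?case using supp
      proof eventually_elim
        case (elim u)
        have "\<bar>u - v\<bar> * \<bar>x - x0\<bar> \<le> R * (1 / R)"
          using elim v that R by (intro mult_mono) (auto simp: dist_real_def)
        then show ?case using R cos1[of "(u - v) * (x - x0)"] by (simp add: G_def abs_mult)
      qed
    qed
    then have "AE w in U \<Otimes>\<^sub>M U. 1 / 2 \<le> G x w"
      by (intro UU.AE_pair_measure) (use G_meas1 in measurable)
    then have "(\<integral>w. 1 / 2 \<partial>(U \<Otimes>\<^sub>M U)) \<le> (\<integral>w. G x w \<partial>(U \<Otimes>\<^sub>M U))"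
      by (intro integral_mono_AE G_int) auto
    then show ?thesis by (simp add: UU.prob_space)
  qed
  have pointwise: "(\<integral>x. G x w \<partial>M) \<le> (case w of (v, u) \<Rightarrow> cmod (char M (u - v)))" for w
  proof (cases w)
    case (Pair v u)
    have int: "integrable M (\<lambda>x. iexp ((u - v) * (x - x0)))"
      by (rule M.integrable_const_bound[where B=1]) (auto simp del: of_real_mult of_real_diff)
    have "(\<integral>x. G x w \<partial>M) = (\<integral>x. Re (iexp ((u - v) * (x - x0))) \<partial>M)"
      by (simp add: G_def Pair Re_exp)
    also have "\<dots> = Re (\<integral>x. iexp ((u - v) * (x - x0)) \<partial>M)"
      by (rule integral_Re[OF int])
    also have "\<dots> = Re (iexp (- (u - v) * x0) * char M (u - v))"
    proof -
      have "iexp ((u - v) * (x - x0)) = iexp (- (u - v) * x0) * iexp ((u - v) * x)" for x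
        by (simp add: exp_add [symmetric] algebra_simps)
      then show ?thesis by (simp add: char_def)
    qed
    also have "\<dots> \<le> cmod (iexp (- (u - v) * x0) * char M (u - v))"
      by (rule complex_Re_le_cmod)
    also have "\<dots> = cmod (char M (u - v))"
      by (simp only: norm_mult norm_exp_i_times mult_1)
    finally show ?thesis by (simp add: Pair)
  qed
  have char_int: "integrable (U \<Otimes>\<^sub>M U) (\<lambda>(v, u). cmod (char M (u - v)))"
    by (rule UU.integrable_const_bound[where B=1]) (auto simp: M.cmod_char_le_1)
  have "1 / 2 * measure M (ball x0 (1 / R)) = (\<integral>x. 1 / 2 * indicator (ball x0 (1 / R)) x \<partial>M)"
    by simp
  also have "\<dots> \<le> (\<integral>x. \<integral>w. G x w \<partial>(U \<Otimes>\<^sub>M U) \<partial>M)"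
  proof (rule integral_mono)
    show "integrable M (\<lambda>x. \<integral>w. G x w \<partial>(U \<Otimes>\<^sub>M U))"
      by (rule UUM.integrable_snd) (use G_int_all in simp)
    show "integrable M (\<lambda>x. 1 / 2 * indicator (ball x0 (1 / R)) x :: real)"
      by (intro integrable_mult_right integrable_real_indicator) (auto simp: M.emeasure_eq_measure)
    show "1 / 2 * indicator (ball x0 (1 / R)) x \<le> (\<integral>w. G x w \<partial>(U \<Otimes>\<^sub>M U))" for x
      using near[of x] nonneg[of x] by (cases "x \<in> ball x0 (1 / R)") (simp_all del: mem_ball)
  qed
  also have "\<dots> = (\<integral>w. \<integral>x. G x w \<partial>M \<partial>(U \<Otimes>\<^sub>M U))"
    by (rule UUM.Fubini_integral) (use G_int_all in simp)
  also have "\<dots> \<le> (\<integral>(v, u). cmod (char M (u - v)) \<partial>(U \<Otimes>\<^sub>M U))"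
    by (rule integral_mono) (use UUM.integrable_fst[OF G_int_all] pointwise char_int in auto)
  also have "\<dots> = (\<integral>v. \<integral>u. cmod (char M (u - v)) \<partial>U \<partial>U)"
    using UU.integral_fst'[OF char_int] by simp
  finally show ?thesis by simp
qed

text \<open>
  The double average for \<open>U\<close> uniform on \<open>[0, 1 / r]\<close>: for fixed \<open>v\<close> the inner average is \<open>r\<close> times
  an integral over an interval of length \<open>1 / r\<close>.
\<close>

lemma Esseen_concentration:
  assumes M: "real_distribution M" and r: "r > 0"
    and K: "\<And>s. (LINT t:{s..s + 1 / r}|lborel. cmod (char M t)) \<le> K"
  shows "measure M (ball x0 r) \<le> 2 * r * K"
proof -
  interpret M: real_distribution M by fact
  define U where "U = uniform_measure lborel {0..1 / r}"
  have U: "real_distribution U"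
    unfolding U_def real_distribution_def real_distribution_axioms_def
    using r by (auto intro!: prob_space_uniform_measure)
  interpret U: real_distribution U by fact
  have U_density: "U = density lborel (\<lambda>x. ennreal (r * indicator {0..1 / r} x))"
    unfolding U_def uniform_measure_def using r
    by (intro density_cong) (auto simp: divide_ennreal ennreal_1[symmetric] simp del: ennreal_1 split: split_indicator)
  have avg: "(\<integral>u. cmod (char M (u - v)) \<partial>U) \<le> r * K" for v
  proof -
    have "(\<integral>u. cmod (char M (u - v)) \<partial>U) = (\<integral>u. r * indicator {0..1 / r} u * cmod (char M (u - v)) \<partial>lborel)"
      unfolding U_density using r by (subst integral_density) (auto simp: mult.assoc)
    also have "\<dots> = r * (\<integral>u. indicator {0..1 / r} (v + 1 * u) * cmod (char M (v + 1 * u - v)) \<partial>lborel)"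
      by (subst lborel_integral_real_affine[where c=1 and t="v"]) (auto simp: mult.assoc)
    also have "(\<integral>u. indicator {0..1 / r} (v + 1 * u) * cmod (char M (v + 1 * u - v)) \<partial>lborel)
        = (LINT t:{- v..- v + 1 / r}|lborel. cmod (char M t))"
      unfolding set_lebesgue_integral_def by (intro Bochner_Integration.integral_cong) (auto split: split_indicator)
    also have "\<dots> \<le> K" by (rule K)
    finally show ?thesis using r by simp
  qed
  have "measure M (ball x0 (1 / (1 / r))) \<le> 2 * (\<integral>v. \<integral>u. cmod (char M (u - v)) \<partial>U \<partial>U)"
  proof (rule Esseen_double_average[OF M U])
    show "AE u in U. u \<in> {0..1 / r}"
      unfolding U_def by (rule AE_uniform_measureI) auto
  qed (use r in simp)
  also have "(\<integral>v. \<integral>u. cmod (char M (u - v)) \<partial>U \<partial>U) \<le> (\<integral>v. r * K \<partial>U)"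
  proof (rule integral_mono)
    show "integrable U (\<lambda>v. \<integral>u. cmod (char M (u - v)) \<partial>U)"
      by (rule U.integrable_const_bound[where B=1])
         (auto intro!: U.integral_le_const U.integrable_const_bound[where B=1] integral_nonneg_AE simp: M.cmod_char_le_1)
  qed (auto simp: avg)
  finally show ?thesis using U.prob_space by simp
qed

section \<open>The characteristic function of a Bernoulli convolution\<close>

text \<open>
  The exponents start at \<open>1\<close>, as in the random series.
\<close>

definition cos_prod :: "real \<Rightarrow> nat \<Rightarrow> real \<Rightarrow> real" where
  "cos_prod a N t = (\<Prod>j<N. \<bar>cos (a ^ Suc j * t)\<bar>)"

lemma cos_prod_nonneg: "0 \<le> cos_prod a N t"
  by (simp add: cos_prod_def prod_nonneg)

lemma continuous_cos_prod: "continuous_on A (cos_prod a N)"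
  unfolding cos_prod_def by (intro continuous_intros)

lemma cos_prod_add: "cos_prod a (N + p) t = cos_prod a N t * cos_prod a p (a ^ N * t)"
  unfolding cos_prod_def lessThan_atLeast0 
  by (subst prod.atLeastLessThan_concat[symmetric, of 0 N "N + p"])
     (auto simp: prod.shift_bounds_nat_ivl[of _ 0 N p, simplified add.commute add_0] power_add ac_simps
        prod.atLeastLessThan_shift_0[of _ N])

lemma coin_sequence_space: "sequence_space (measure_pmf (pmf_of_set (UNIV :: bool set)))"
  by unfold_locales

lemma measurable_coin_series [measurable]:
  "(\<lambda>\<omega>. \<Sum>n. sign_of (\<omega> n) * a ^ Suc n) \<in> borel_measurable coin_space"
  unfolding coin_space_def by measurable

lemma prob_space_coin_space: "prob_space coin_space"
  unfolding coin_space_def by (intro prob_space_PiM measure_pmf.prob_space_axioms)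

lemma real_distribution_bernoulli_convolution: "real_distribution (bernoulli_convolution a)"
  unfolding bernoulli_convolution_def
  by (intro prob_space.real_distribution_distr prob_space_coin_space measurable_coin_series)

text \<open>
  Splitting off the first coin, the random series is \<open>\<plusminus>a\<close> plus \<open>a\<close> times an independent copy of itself.
\<close>

lemma char_bernoulli_convolution_self_similar:
  assumes a: "0 < a" "a < 1"
  shows "char (bernoulli_convolution a) t = of_real (cos (a * t)) * char (bernoulli_convolution a) (a * t)"
proof -
  define X where "X = (\<lambda>\<omega>. \<Sum>n. sign_of (\<omega> n) * a ^ Suc n)"
  define B where "B = measure_pmf (pmf_of_set (UNIV :: bool set))"
  interpret sequence_space B unfolding B_def by (rule coin_sequence_space)
  have S: "coin_space = S" by (simp add: coin_space_def B_def)
  have X_meas [measurable]: "X \<in> borel_measurable S"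
    unfolding X_def S[symmetric] by measurable
  have [measurable]: "sign_of \<in> borel_measurable B"
    by (simp add: B_def)
  have summ: "summable (\<lambda>n. sign_of (\<omega> n) * a ^ Suc n)" for \<omega>
    by (rule summable_comparison_test'[of "\<lambda>n. a ^ Suc n"])
       (use a in \<open>auto simp: sign_of_def abs_mult simp del: power_Suc intro: summable_geometric summable_Suc_iff[THEN iffD2]\<close>)
  have X_step: "X (case_nat b \<omega>) = a * sign_of b + a * X \<omega>" for b \<omega>
  proof -
    have "X (case_nat b \<omega>) = (\<Sum>n. sign_of (\<omega> n) * a ^ Suc (Suc n)) + sign_of b * a"
      using suminf_split_head[OF summ[of "case_nat b \<omega>"]] by (simp add: X_def)
    also have "(\<Sum>n. sign_of (\<omega> n) * a ^ Suc (Suc n)) = a * X \<omega>"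
      unfolding X_def suminf_mult[OF summ, symmetric] by (simp add: mult_ac)
    finally show ?thesis by simp
  qed
  have char_eq: "char (bernoulli_convolution a) t = (CLINT \<omega>|S. iexp (t * X \<omega>))" for t
    unfolding char_def bernoulli_convolution_def X_def[symmetric] S by (subst integral_distr) auto
  have "char (bernoulli_convolution a) t
      = (CLINT \<omega>|distr (B \<Otimes>\<^sub>M S) S (\<lambda>(b, \<omega>). case_nat b \<omega>). iexp (t * X \<omega>))"
    unfolding PiM_iter char_eq ..
  also have "\<dots> = (CLINT z|B \<Otimes>\<^sub>M S. iexp (t * X (case z of (b, \<omega>) \<Rightarrow> case_nat b \<omega>)))"
    by (subst integral_distr) auto
  also have "\<dots> = (CLINT z|B \<Otimes>\<^sub>M S. (case z of (b, \<omega>) \<Rightarrow> iexp (a * t * sign_of b) * iexp (a * t * X \<omega>)))"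
    by (intro Bochner_Integration.integral_cong)
       (auto simp: X_step exp_add[symmetric] algebra_simps)
  also have "\<dots> = (CLINT b|B. CLINT \<omega>|S. iexp (a * t * sign_of b) * iexp (a * t * X \<omega>))"
  proof -
    interpret BS: pair_prob_space B S ..
    have "integrable (B \<Otimes>\<^sub>M S) (\<lambda>(b, \<omega>). iexp (a * t * sign_of b) * iexp (a * t * X \<omega>))"
      by (rule BS.integrable_const_bound[where B=1])
         (auto simp: norm_mult simp del: of_real_mult)
    from BS.integral_fst'[OF this] show ?thesis by simp
  qed
  also have "\<dots> = (CLINT b|B. iexp (a * t * sign_of b)) * char (bernoulli_convolution a) (a * t)"
    by (simp add: char_eq mult.assoc)
  also have "(CLINT b|B. iexp (a * t * sign_of b)) = of_real (cos (a * t))"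
    unfolding B_def
    by (subst integral_measure_pmf[of UNIV])
       (auto simp: UNIV_bool sign_of_def cos_exp_eq scaleR_conv_of_real add_divide_distrib simp flip: cos_of_real)
  finally show ?thesis .
qed

lemma cmod_char_bernoulli_convolution_le:
  assumes a: "0 < a" "a < 1"
  shows "cmod (char (bernoulli_convolution a) t) \<le> cos_prod a N t"
proof -
  interpret real_distribution "bernoulli_convolution a"
    by (rule real_distribution_bernoulli_convolution)
  have "cmod (char (bernoulli_convolution a) t)
      = cos_prod a N t * cmod (char (bernoulli_convolution a) (a ^ N * t))"
  proof (induction N)
    case (Suc N)
    then show ?case
      by (subst (asm) (2) char_bernoulli_convolution_self_similar[OF a])
         (simp add: cos_prod_def norm_mult mult.assoc mult.left_commute)
  qed (simp add: cos_prod_def)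
  also have "\<dots> \<le> cos_prod a N t"
    by (intro mult_left_le cmod_char_le_1 cos_prod_nonneg)
  finally show ?thesis .
qed


section \<open>Integrals of products of cosines\<close>

text \<open>
  This turns products of cosines into a cost that behaves well under differences: by
  \<open>\<bar>sin (x - y)\<bar> \<le> \<bar>sin x\<bar> + \<bar>sin y\<bar>\<close>, two points of low cost have a difference of low cost.
\<close>

lemma cos_prod_le_exp:
  "cos_prod a p u \<le> exp (- (\<Sum>j<p. (sin (a ^ Suc j * u))\<^sup>2) / 2)"
proof -
  have cos_le: "\<bar>cos x\<bar> \<le> exp (- (sin x)\<^sup>2 / 2)" for x :: real
  proof (rule power2_le_imp_le)
    have "\<bar>cos x\<bar>\<^sup>2 = 1 + - (sin x)\<^sup>2" by (simp add: cos_squared_eq)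
    also have "\<dots> \<le> exp (- (sin x)\<^sup>2)" by (rule exp_ge_add_one_self)
    also have "\<dots> = (exp (- (sin x)\<^sup>2 / 2))\<^sup>2" by (simp flip: exp_double)
    finally show "\<bar>cos x\<bar>\<^sup>2 \<le> (exp (- (sin x)\<^sup>2 / 2))\<^sup>2" .
  qed simp
  have "cos_prod a p u \<le> (\<Prod>j<p. exp (- (sin (a ^ Suc j * u))\<^sup>2 / 2))"
    unfolding cos_prod_def by (intro prod_mono) (use cos_le in auto)
  also have "\<dots> = exp (- (\<Sum>j<p. (sin (a ^ Suc j * u))\<^sup>2) / 2)"
    by (simp add: sum_divide_distrib flip: exp_sum sum_negf)
  finally show ?thesis .
qed

lemma sin_squared_diff_le: "(sin (x - y))\<^sup>2 \<le> 2 * ((sin x)\<^sup>2 + (sin y)\<^sup>2)" for x y :: real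
proof -
  have "\<bar>sin (x - y)\<bar> \<le> \<bar>sin x * cos y\<bar> + \<bar>cos x * sin y\<bar>"
    unfolding sin_diff by (rule abs_triangle_ineq4)
  also have "\<dots> \<le> \<bar>sin x\<bar> + \<bar>sin y\<bar>"
    unfolding abs_mult by (intro add_mono mult_left_le mult_left_le_one_le) auto
  finally have "(sin (x - y))\<^sup>2 \<le> (\<bar>sin x\<bar> + \<bar>sin y\<bar>)\<^sup>2"
    by (metis abs_ge_zero power2_abs power_mono)
  also have "\<dots> \<le> 2 * ((sin x)\<^sup>2 + (sin y)\<^sup>2)"
    using sum_squares_bound[of "\<bar>sin x\<bar>" "\<bar>sin y\<bar>"] by (simp add: power2_sum)
  finally show ?thesis .
qed

lemma sin_ge_half: "x / 2 \<le> sin x" if "0 \<le> x" "x \<le> 1" for x :: real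
proof -
  have "\<bar>sin x - x\<bar> \<le> \<bar>x\<bar> ^ 3 / 6"
    using Maclaurin_sin_bound[of x 3] by (simp add: sin_coeff_def numeral_eq_Suc)
  moreover have "x ^ 3 \<le> x" using that power_decreasing[of 1 3 x] by simp
  ultimately show ?thesis using that unfolding abs_le_iff by simp
qed

text \<open>
  If \<open>\<bar>u - v\<bar>\<close> were in \<open>(1/2, 1]\<close>, then \<open>a\<^sup>j \<bar>u - v\<bar>\<close> would be in \<open>[1/4, 1]\<close> for all \<open>j \<le> p\<close>, so each
  \<open>sin\<^sup>2\<close> would be at least \<open>1/64\<close> and the cost of \<open>u - v\<close> at least \<open>p / 64\<close>. But the costs of \<open>u\<close> and
  \<open>v\<close> are below \<open>p / 256\<close> each, which bounds the cost of \<open>u - v\<close> strictly by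
  \<open>2 (p / 256 + p / 256) = p / 64\<close>.
\<close>

lemma cos_prod_large_diam:
  assumes a: "0 < a" "a < 1" and p: "a ^ p \<ge> 1 / 2"
    and u: "cos_prod a p u > exp (- real p / 512)" and v: "cos_prod a p v > exp (- real p / 512)"
    and uv: "\<bar>u - v\<bar> \<le> 1"
  shows "\<bar>u - v\<bar> \<le> 1 / 2"
proof (rule ccontr)
  assume "\<not> \<bar>u - v\<bar> \<le> 1 / 2"
  define E where "E = (\<lambda>x. \<Sum>j<p. (sin (a ^ Suc j * x))\<^sup>2)"
  have small: "E x < real p / 256" if "cos_prod a p x > exp (- real p / 512)" for x
    using less_le_trans[OF that cos_prod_le_exp] by (simp add: E_def)
  have "1 / 64 \<le> (sin (a ^ Suc j * (u - v)))\<^sup>2" if j: "j < p" for j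
  proof -
    have "1 / 2 \<le> a ^ Suc j"
      using p power_decreasing[of "Suc j" p a] a j by linarith
    moreover have "a ^ Suc j \<le> 1" using a by (intro power_le_one) auto
    ultimately have *: "1 / 2 * (1 / 2) \<le> a ^ Suc j * \<bar>u - v\<bar>" "a ^ Suc j * \<bar>u - v\<bar> \<le> 1 * 1"
      using \<open>\<not> \<bar>u - v\<bar> \<le> 1 / 2\<close> uv by (intro mult_mono; simp)+
    then have "1 / 8 \<le> sin (a ^ Suc j * \<bar>u - v\<bar>)"
      using sin_ge_half[of "a ^ Suc j * \<bar>u - v\<bar>"] by linarith
    then have "(1 / 8)\<^sup>2 \<le> (sin (a ^ Suc j * \<bar>u - v\<bar>))\<^sup>2"
      by (intro power_mono) auto
    also have "a ^ Suc j * \<bar>u - v\<bar> = \<bar>a ^ Suc j * (u - v)\<bar>"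
      using a by (simp add: abs_mult)
    also have "(sin \<bar>a ^ Suc j * (u - v)\<bar>)\<^sup>2 = (sin (a ^ Suc j * (u - v)))\<^sup>2"
      by (simp add: abs_if del: power_Suc)
    finally show ?thesis by (simp add: power2_eq_square)
  qed
  then have "(\<Sum>j<p. 1 / 64) \<le> E (u - v)"
    unfolding E_def by (intro sum_mono) auto
  also have "\<dots> \<le> 2 * (E u + E v)"
    unfolding E_def right_diff_distrib
    by (simp add: sum_distrib_left sin_squared_diff_le flip: sum.distrib del: power_Suc)
       (intro sum_mono sin_squared_diff_le[unfolded distrib_left])
  finally show False using small[OF u] small[OF v] by simp
qed

lemma bounded_diam_imp_subset_Icc:
  fixes G :: "real set"
  assumes "\<And>x y. x \<in> G \<Longrightarrow> y \<in> G \<Longrightarrow> \<bar>x - y\<bar> \<le> l"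
  obtains z where "G \<subseteq> {z..z + l}"
proof (cases "G = {}")
  case False
  then obtain g where g: "g \<in> G" by blast
  have bdd: "bdd_below G"
    using assms[OF g] by (intro bdd_belowI[of _ "g - l"]) (auto simp: abs_le_iff algebra_simps)
  have "x \<le> Inf G + l" if "x \<in> G" for x
  proof -
    have "x - l \<le> Inf G"
      using False assms[OF that] by (intro cInf_greatest) (auto simp: abs_le_iff algebra_simps)
    then show ?thesis by simp
  qed
  then show thesis using bdd by (intro that[of "Inf G"]) (auto intro: cInf_lower)
qed (use that in auto)

text \<open>
  Induction on the number \<open>n\<close> of blocks, for all positions \<open>s\<close> of the interval at once. The new block
  contributes the lowest frequencies, so it is a function of \<open>a ^ (n * p) * t\<close>. Where it exceeds
  \<open>\<delta>\<close> it is bounded by \<open>1\<close>, and these \<open>t\<close> fit into one interval \<open>{z..z + l}\<close> of the previous length.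
  Elsewhere it is bounded by \<open>\<delta>\<close>, and two intervals of length \<open>l\<close> cover everything.
\<close>

lemma cos_prod_integral_le:
  assumes a: "0 < a" "a < 1" and p: "a ^ p \<ge> 1 / 2"
  shows "(LINT t:{s..s + 1 / (2 * a ^ (n * p))}|lborel. cos_prod a (n * p) t)
    \<le> (1 + 2 * exp (- real p / 512)) ^ n / 2"
proof (induction n arbitrary: s)
  case 0
  then show ?case by (simp add: cos_prod_def set_lebesgue_integral_def)
next
  case (Suc n)
  define \<delta> where "\<delta> = exp (- real p / 512)"
  define N where "N = n * p"
  define l where "l = 1 / (2 * a ^ N)"
  define f where "f = cos_prod a N"
  have aN: "a ^ N > 0" using a by simp
  have l: "l \<ge> 0" "a ^ N * l = 1 / 2" using a by (simp_all add: l_def)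
  have len: "1 / (2 * a ^ (Suc n * p)) \<le> 2 * l"
    using aN p by (simp add: l_def N_def power_add field_simps)
  have IH: "(LINT t:{s..s + l}|lborel. f t) \<le> (1 + 2 * \<delta>) ^ n / 2" for s
    using Suc.IH[of s] by (simp add: l_def f_def N_def \<delta>_def)
  have int: "integrable lborel (\<lambda>t. indicator {s..s'} t * f t)" for s s'
    using borel_integrable_atLeastAtMost'[OF continuous_cos_prod, of s s' a N]
    by (simp add: set_integrable_def f_def)
  define I where "I = {s..s + 1 / (2 * a ^ (Suc n * p))}"
  define G where "G = {t \<in> I. cos_prod a p (a ^ N * t) > \<delta>}"
  have "\<bar>x - y\<bar> \<le> l" if "x \<in> G" "y \<in> G" for x y
  proof -
    have scale: "\<bar>a ^ N * x - a ^ N * y\<bar> = a ^ N * \<bar>x - y\<bar>"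
      using aN by (simp add: abs_mult flip: right_diff_distrib)
    have "\<bar>x - y\<bar> \<le> 2 * l" using that len by (auto simp: G_def I_def)
    then have "\<bar>a ^ N * x - a ^ N * y\<bar> \<le> 1"
      unfolding scale using aN by (simp add: l_def field_simps)
    then have "\<bar>a ^ N * x - a ^ N * y\<bar> \<le> 1 / 2"
      using that by (intro cos_prod_large_diam[OF a p]) (auto simp: G_def \<delta>_def)
    then show ?thesis
      unfolding scale using aN by (simp add: l_def field_simps)
  qed
  then obtain z where z: "G \<subseteq> {z..z + l}" by (rule bounded_diam_imp_subset_Icc)
  have "(LINT t:I|lborel. cos_prod a (Suc n * p) t)
      \<le> (LINT t|lborel. indicator {z..z + l} t * f t
          + \<delta> * (indicator {s..s + l} t * f t + indicator {s + l..s + l + l} t * f t))"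
    unfolding set_lebesgue_integral_def
  proof (rule integral_mono)
    show "integrable lborel (\<lambda>t. indicator I t *\<^sub>R cos_prod a (Suc n * p) t)"
      using borel_integrable_atLeastAtMost'[OF continuous_cos_prod] by (simp add: set_integrable_def I_def)
    fix t
    have split: "cos_prod a (Suc n * p) t = f t * cos_prod a p (a ^ N * t)"
      using cos_prod_add[of a N p t] by (simp add: f_def N_def add.commute)
    have f: "f t \<ge> 0" by (simp add: f_def cos_prod_nonneg)
    have \<delta>: "\<delta> \<ge> 0" by (simp add: \<delta>_def)
    show "indicator I t *\<^sub>R cos_prod a (Suc n * p) t \<le> indicator {z..z + l} t * f t
        + \<delta> * (indicator {s..s + l} t * f t + indicator {s + l..s + l + l} t * f t)"
    proof (cases "t \<in> I")
      case True
      then have cover: "t \<in> {s..s + l} \<or> t \<in> {s + l..s + l + l}" using len by (auto simp: I_def)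
      show ?thesis
      proof (cases "t \<in> G")
        case True
        then have "t \<in> {z..z + l}" using z by blast
        moreover have "cos_prod a p (a ^ N * t) \<le> 1"
          unfolding cos_prod_def by (intro prod_le_1) auto
        moreover from this have "cos_prod a (Suc n * p) t \<le> f t"
          unfolding split using f by (intro mult_left_le)
        moreover have "0 \<le> \<delta> * (indicator {s..s + l} t * f t + indicator {s + l..s + l + l} t * f t)"
          using f \<delta> by simp
        ultimately show ?thesis using \<open>t \<in> I\<close> by (simp del: mult_Suc)
      next
        case False
        then have "f t * cos_prod a p (a ^ N * t) \<le> f t * \<delta>"
          using True f by (intro mult_left_mono) (auto simp: G_def)
        also have "\<dots> \<le> \<delta> * (indicator {s..s + l} t * f t + indicator {s + l..s + l + l} t * f t)"
          using cover f \<delta> by (auto simp: mult.commute split: split_indicator)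
        finally show ?thesis using \<open>t \<in> I\<close> f by (simp add: split add_increasing del: mult_Suc)
      qed
    qed (use f \<delta> in simp)
  qed (intro Bochner_Integration.integrable_add integrable_mult_right int)
  also have "\<dots> = (LINT t:{z..z + l}|lborel. f t)
      + \<delta> * ((LINT t:{s..s + l}|lborel. f t) + (LINT t:{s + l..s + l + l}|lborel. f t))"
    by (simp add: set_lebesgue_integral_def int)
  also have "\<dots> \<le> (1 + 2 * \<delta>) ^ n / 2 + \<delta> * ((1 + 2 * \<delta>) ^ n / 2 + (1 + 2 * \<delta>) ^ n / 2)"
    by (intro add_mono mult_left_mono IH) (simp add: \<delta>_def)
  also have "\<dots> = (1 + 2 * \<delta>) ^ Suc n / 2" by (simp add: field_simps)
  finally show ?case by (simp add: I_def \<delta>_def)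
qed

section \<open>The Frostman exponent\<close>

text \<open>
  With an empty support, the open null sets would cover the space, and by the Lindelof property
  countably many of them would.
\<close>

lemma measure_support_nonempty:
  fixes M :: "'a::second_countable_topology measure"
  assumes "sets M = sets borel" "emeasure M (space M) \<noteq> 0"
  shows "measure_support M \<noteq> {}"
proof
  assume empty: "measure_support M = {}"
  define F where "F = {U. open U \<and> emeasure M U = 0}"
  obtain F' where F': "F' \<subseteq> F" "countable F'" "\<Union>F' = \<Union>F"
    using Lindelof[of F] by (auto simp: F_def)
  have "\<Union>F = UNIV"
    using empty by (auto simp: F_def measure_support_def)
  moreover have "(\<Union>U\<in>F'. U) \<in> null_sets M"
    by (rule null_sets_UN') (use F' assms(1) in \<open>auto simp: F_def null_sets_def\<close>)
  moreover have "space M = UNIV" using assms(1) sets_eq_imp_space_eq by fastforce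
  ultimately show False using assms(2) F'(3) by (auto simp: null_sets_def)
qed

text \<open>
  Dividing \<open>ln (C * r powr d) = ln C + d * ln r\<close> by \<open>ln r < 0\<close> reverses the inequality, and
  \<open>ln C / ln r\<close> tends to \<open>0\<close>.
\<close>

lemma frostman_exponent_ge:
  assumes M: "real_distribution M" and "C > 0"
    and le: "\<And>r x. 0 < r \<Longrightarrow> r < 1 \<Longrightarrow> measure M (ball x r) \<le> C * r powr d"
  shows "frostman_exponent M \<ge> ereal d"
proof -
  interpret real_distribution M by fact
  define S where "S = (\<lambda>r. SUP x\<in>measure_support M. measure M (ball x r))"
  obtain x0 where x0: "x0 \<in> measure_support M"
    using measure_support_nonempty[of M] emeasure_space_1 by auto
  have "ln C / ln r + d \<le> ln (S r) / ln r" if r: "0 < r" "r < 1" for r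
  proof -
    have "bdd_above ((\<lambda>x. measure M (ball x r)) ` measure_support M)"
      by (rule bdd_aboveI2[of _ _ 1]) (rule prob_le_1)
    then have "measure M (ball x0 r) \<le> S r"
      unfolding S_def by (rule cSUP_upper[OF x0])
    moreover have "measure M (ball x0 r) > 0"
      using x0 r by (auto simp: measure_support_def emeasure_eq_measure)
    ultimately have pos: "S r > 0" by linarith
    have "S r \<le> C * r powr d"
      unfolding S_def using x0 r le by (intro cSUP_least) auto
    then have "ln (S r) \<le> ln (C * r powr d)" using pos by simp
    also have "\<dots> = ln C + d * ln r" using \<open>C > 0\<close> r by (simp add: ln_mult ln_powr)
    finally have "(ln C + d * ln r) / ln r \<le> ln (S r) / ln r"
      by (rule divide_right_mono_neg) (use r in simp)
    then show ?thesis using r by (simp add: add_divide_distrib)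
  qed
  then have "\<forall>\<^sub>F r in at_right 0. ereal (ln C / ln r + d) \<le> ereal (ln (S r) / ln r)"
    by (auto simp: eventually_at_right_field intro!: exI[of _ 1])
  then have "Liminf (at_right 0) (\<lambda>r. ereal (ln C / ln r + d)) \<le> frostman_exponent M"
    unfolding frostman_exponent_def S_def by (rule Liminf_mono)
  moreover have "((\<lambda>r. ln C / ln r + d) \<longlongrightarrow> 0 + d) (at_right 0)"
    by (intro tendsto_intros tendsto_divide_0[OF tendsto_const] filterlim_at_bot_imp_at_infinity ln_at_0)
  then have "Liminf (at_right 0) (\<lambda>r. ereal (ln C / ln r + d)) = ereal d"
    by (intro lim_imp_Liminf) auto
  ultimately show ?thesis by simp
qed

text \<open>
  The \<open>n\<close> blocks reach the frequency \<open>1 / r\<close> once \<open>a ^ (n * p) \<le> r / 2\<close>. A block shrinks by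
  \<open>a\<^sup>p \<le> exp (- p (1 - a)) \<le> exp (- 1/4)\<close>, so \<open>n\<close> of about \<open>4 ln (2 / r)\<close> is enough, and
  \<open>(1 + 2 \<delta>)\<^sup>n \<le> exp (2 \<delta> n)\<close> is at most a constant times \<open>r powr (- 8 \<delta>)\<close>.
\<close>

lemma bernoulli_convolution_ball_le:
  assumes a: "0 < a" "a < 1" and p: "a ^ p \<ge> 1 / 2" "real p * (1 - a) \<ge> 1 / 4"
    and r: "0 < r" "r < 1"
  defines "\<delta> \<equiv> exp (- real p / 512)"
  shows "measure (bernoulli_convolution a) (ball x r) \<le> exp (10 * \<delta>) * r powr (1 - 8 * \<delta>)"
proof -
  interpret real_distribution "bernoulli_convolution a"
    by (rule real_distribution_bernoulli_convolution)
  define n where "n = nat \<lceil>4 * ln (2 / r)\<rceil>"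
  have "ln (2 / r) > 0" using r by simp
  then have n: "real n \<ge> 4 * ln (2 / r)" "real n \<le> 4 * ln (2 / r) + 1"
    by (auto simp: n_def)
  have \<delta>: "\<delta> > 0" by (simp add: \<delta>_def)
  have "a \<le> exp (- (1 - a))" using exp_ge_add_one_self[of "- (1 - a)"] by simp
  then have "a ^ (n * p) \<le> exp (- (1 - a)) ^ (n * p)"
    using a by (intro power_mono) auto
  also have "\<dots> = exp (- (real n * (real p * (1 - a))))"
    by (simp add: algebra_simps flip: exp_of_nat_mult)
  also have "\<dots> \<le> exp (- (real n * (1 / 4)))"
    using p(2) by (simp only: exp_le_cancel_iff neg_le_iff_le) (intro mult_left_mono; simp)
  also have "\<dots> \<le> exp (- ln (2 / r))" using n(1) by simp
  also have "\<dots> = r / 2" using r by (simp add: exp_minus)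
  finally have len: "1 / r \<le> 1 / (2 * a ^ (n * p))"
    using a r by (simp add: field_simps)
  have K: "(LINT t:{s..s + 1 / r}|lborel. cmod (char (bernoulli_convolution a) t)) \<le> (1 + 2 * \<delta>) ^ n / 2"
    for s
  proof -
    have "(LINT t:{s..s + 1 / r}|lborel. cmod (char (bernoulli_convolution a) t))
        \<le> (LINT t:{s..s + 1 / (2 * a ^ (n * p))}|lborel. cos_prod a (n * p) t)"
      unfolding set_lebesgue_integral_def
    proof (rule integral_mono)
      have "continuous_on A (\<lambda>t. cmod (char (bernoulli_convolution a) t))" for A
        by (intro continuous_at_imp_continuous_on ballI continuous_norm isCont_char)
      from borel_integrable_atLeastAtMost'[OF this]
      show "integrable lborel
          (\<lambda>t. indicator {s..s + 1 / r} t *\<^sub>R cmod (char (bernoulli_convolution a) t))"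
        by (simp add: set_integrable_def)
      show "integrable lborel
          (\<lambda>t. indicator {s..s + 1 / (2 * a ^ (n * p))} t *\<^sub>R cos_prod a (n * p) t)"
        using borel_integrable_atLeastAtMost'[OF continuous_cos_prod] by (simp add: set_integrable_def)
    qed (use cmod_char_bernoulli_convolution_le[OF a, of _ "n * p"] len cos_prod_nonneg in
          \<open>auto split: split_indicator\<close>)
    also have "\<dots> \<le> (1 + 2 * \<delta>) ^ n / 2"
      unfolding \<delta>_def by (rule cos_prod_integral_le[OF a p(1)])
    finally show ?thesis .
  qed
  have "measure (bernoulli_convolution a) (ball x r) \<le> 2 * r * ((1 + 2 * \<delta>) ^ n / 2)"
    by (rule Esseen_concentration[OF real_distribution_bernoulli_convolution r(1) K])
  also have "\<dots> = r * (1 + 2 * \<delta>) ^ n" by simp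
  also have "\<dots> \<le> r * exp (2 * \<delta>) ^ n"
    using \<delta> r by (intro mult_left_mono power_mono exp_ge_add_one_self) auto
  also have "\<dots> = r * exp (2 * \<delta> * real n)"
    by (simp add: mult_ac flip: exp_of_nat_mult)
  also have "\<dots> \<le> r * exp (2 * \<delta> * (5 - 4 * ln r))"
    using n(2) ln_2_less_1 \<delta> r by (intro mult_left_mono iffD2[OF exp_le_cancel_iff]) (auto simp: ln_div)
  also have "\<dots> = exp (10 * \<delta>) * r powr (1 - 8 * \<delta>)"
    using r by (simp add: powr_def algebra_simps exp_diff exp_add exp_minus)
  finally show ?thesis .
qed

text \<open>
  The block length is \<open>p = \<lfloor>1 / (2 (1 - a))\<rfloor>\<close>: Bernoulli's inequality gives
  \<open>a\<^sup>p \<ge> 1 - p (1 - a) \<ge> 1/2\<close>, and rounding down loses at most a factor \<open>2\<close>.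
\<close>

lemma frostman_exponent_bernoulli_convolution_ge:
  assumes a: "1 / 2 \<le> a" "a < 1"
  shows "frostman_exponent (bernoulli_convolution a) \<ge> ereal (1 - 8 * exp (- 1 / (2048 * (1 - a))))"
proof -
  define y where "y = 1 / (2 * (1 - a))"
  define p where "p = nat \<lfloor>y\<rfloor>"
  have "y \<ge> 1" using a by (simp add: y_def field_simps)
  then have "1 \<le> \<lfloor>y\<rfloor>" by simp
  then have "real p \<le> y" "real p \<ge> y / 2"
    unfolding p_def by linarith+
  then have p: "real p \<le> 1 / (2 * (1 - a))" "real p \<ge> 1 / (4 * (1 - a))"
    by (simp_all add: y_def)
  have ap: "real p * (1 - a) \<le> 1 / 2" "real p * (1 - a) \<ge> 1 / 4"
    using p a by (simp_all add: field_simps)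
  have "a ^ p \<ge> 1 / 2"
    using Bernoulli_inequality[of "- (1 - a)" p] ap a by (simp add: algebra_simps)
  then have "ereal (1 - 8 * exp (- real p / 512)) \<le> frostman_exponent (bernoulli_convolution a)"
    using a ap(2)
    by (intro frostman_exponent_ge[where C = "exp (10 * exp (- real p / 512))"] bernoulli_convolution_ball_le
        real_distribution_bernoulli_convolution) auto
  moreover have "exp (- real p / 512) \<le> exp (- 1 / (2048 * (1 - a)))"
    using p(2) a by (simp add: field_simps)
  ultimately show ?thesis
    by (meson diff_left_mono ereal_less_eq(3) mult_left_mono order_trans zero_le_numeral)
qed

text \<open>
  It remains to compare \<open>8 exp (- x)\<close>, for \<open>x = 1 / (2048 \<epsilon>)\<close>, with \<open>\<epsilon>\<^sup>2 ln (1 / \<epsilon>)\<close>. The bound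
  \<open>exp (- x) \<le> 2 / x\<^sup>2\<close> suffices, and \<open>\<epsilon> < 1/4\<close> ensures \<open>ln (1 / \<epsilon>) \<ge> 1\<close>.
\<close>

theorem corollary5p3:
  shows "\<exists>C::real. C > 0 \<and> (\<exists>a0::real. 0 < a0 \<and> a0 < 1 \<and>
    (\<forall>a::real. a0 < a \<longrightarrow> a < 1 \<longrightarrow>
       frostman_exponent (bernoulli_convolution a)
         \<ge> ereal (1 - C * (1 - a)\<^sup>2 * ln (1 / (1 - a)))))"
proof (rule exI[of _ "16 * 2048\<^sup>2 :: real"], rule conjI, simp,
    rule exI[of _ "3 / 4 :: real"], intro conjI allI impI)
  fix a :: real
  assume a: "3 / 4 < a" "a < 1"
  define \<epsilon> where "\<epsilon> = 1 - a"
  have \<epsilon>: "0 < \<epsilon>" "\<epsilon> < 1 / 4" using a by (auto simp: \<epsilon>_def)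
  have "exp (1 :: real) \<le> 1 / \<epsilon>"
    using exp_le \<epsilon> by (intro order_trans[OF exp_le]) (simp add: field_simps)
  then have ln: "1 \<le> ln (1 / \<epsilon>)" using \<epsilon> by (simp add: ln_ge_iff)
  define x where "x = 1 / (2048 * \<epsilon>)"
  have x: "x > 0" using \<epsilon> by (simp add: x_def)
  have "x\<^sup>2 / 2 \<le> exp x" using exp_lower_Taylor_quadratic[of x] x by simp
  then have "exp (- x) \<le> 2 / x\<^sup>2"
    using x by (simp add: exp_minus field_simps)
  also have "\<dots> = 2 * 2048\<^sup>2 * \<epsilon>\<^sup>2" by (simp add: x_def power2_eq_square)
  also have "\<dots> \<le> 2 * 2048\<^sup>2 * \<epsilon>\<^sup>2 * ln (1 / \<epsilon>)" using ln by (simp add: mult_le_cancel_left1)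
  finally have "1 - 16 * 2048\<^sup>2 * \<epsilon>\<^sup>2 * ln (1 / \<epsilon>) \<le> 1 - 8 * exp (- x)" by (simp add: mult_ac)
  then have "ereal (1 - 16 * 2048\<^sup>2 * \<epsilon>\<^sup>2 * ln (1 / \<epsilon>)) \<le> ereal (1 - 8 * exp (- x))"
    by (simp only: ereal_less_eq)
  also have "\<dots> \<le> frostman_exponent (bernoulli_convolution a)"
    using frostman_exponent_bernoulli_convolution_ge[of a] a by (simp add: x_def \<epsilon>_def)
  finally show "ereal (1 - 16 * 2048\<^sup>2 * (1 - a)\<^sup>2 * ln (1 / (1 - a)))
      \<le> frostman_exponent (bernoulli_convolution a)"
    by (simp only: \<epsilon>_def)
qed auto

end
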